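(* The Peano continuum $B\subset\mathbb{R}^3$ (the topologist's sine curve rotated about its initial point, together with the limiting outer annulus and connecting arcs, constructed in the context) is not $\pi_1$-shape injective.
   Context: Construction of $B$. Use cylindrical coordinates $(r,\varphi,z)$ on $\mathbb{R}^3$ and fix $r_0>0$. First let $A=S\cup L\cup\bigcup_n\sigma_n$, where $S=\{(r,\varphi,z): 0<r\le r_0,\ \varphi\in\mathbb{R}/2\pi\mathbb{Z},\ z=\sin(1/r)\}$, $L=\{(0,\varphi,z): \varphi\in\mathbb{R}/2\pi\mathbb{Z},\ -1\le z\le 1\}$, and $\sigma_n=\{(r,\varphi_n,z_n): 0\le r\le r_n\}$, $n\ge 1$, where $0<r_n\le r_0$, $r_n\to 0$, $z_n=\sin(1/r_n)$, and the set of pairs $\{(\varphi_n,z_n)\}$ is dense in $(\mathbb{R}/2\pi\mathbb{Z})\times[-1,1]$. Then $$B=\{(r_0-r,\varphi,z): (r,\varphi,z)\in A,\ 0\le r\le r_0\},$$ with the subspace topology from $\mathbb{R}^3$. Here the central arc $L$ (all triples $(0,\varphi,z)$ with $-1\le z\le 1$ and arbitrary $\varphi$) becomes the outer annulus $\{(r_0,\varphi,z): -1\le z\le 1\}$; the surface becomes $\{(r_0-r,\varphi,\sin(1/r)): 0<r\le r_0\}$, which is homeomorphic to $\mathbb{R}^2$; and the connecting arcs become the segments $\{(r_0-r,\varphi_n,z_n): 0\le r\le r_n\}$, which limit on every point of the outer annulus. The space $B$ is a Peano continuum (compact, connected, locally connected metric space). A loop in a space is nulhomotopic (inessential) if it extends,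 as a map from $S^1$, to a map from the closed disc $B^2$; otherwise it is essential. A space $X$ is $\pi_1$-shape injective (or shape injective) if there is an absolute retract $R$ containing $X$ as a closed subspace such that for every essential closed curve $\gamma$ in $X$ there is a neighborhood $V$ of $X$ in $R$ such that $\gamma$ is essential in $V$. (This condition does not depend on the choice of the absolute retract $R$ containing $X$ as a closed subspace; for subspaces of $\mathbb{R}^3$ one may take $R=\mathbb{R}^3$.) *)

theory Defs
  imports "HOL-Analysis.Analysis"
begin

definition loop_in :: "'a topology \<Rightarrow> (complex \<Rightarrow> 'a) \<Rightarrow> bool" where
  "loop_in X \<gamma> \<longleftrightarrow> continuous_map (top_of_set (sphere 0 1)) X \<gamma>"

definition inessential :: "'a topology \<Rightarrow> (complex \<Rightarrow> 'a) \<Rightarrow> bool" where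
  "inessential X \<gamma> \<longleftrightarrow>
     (\<exists>F. continuous_map (top_of_set (cball 0 1)) X F \<and> (\<forall>x\<in>sphere 0 1. F x = \<gamma> x))"

definition essential :: "'a topology \<Rightarrow> (complex \<Rightarrow> 'a) \<Rightarrow> bool" where
  "essential X \<gamma> \<longleftrightarrow> loop_in X \<gamma> \<and> \<not> inessential X \<gamma>"

text \<open>
  Absolute retracts for the class of metrizable spaces: every closed embedded copy in a metrizable
  space is a retract. HOL cannot quantify over the type carrying the surrounding space \<open>Y\<close>, but the
  type \<open>'r \<Rightarrow> real\<close> loses no generality: by the Kuratowski--Wojdyslawski theorem, \<open>R\<close> embeds by
  \<open>x \<mapsto> min 1 (d x _)\<close> as a closed subset of the convex hull of its image, with the sup metric, and
  by Dugundji's theorem a retract of that hull is an absolute retract in the unrestricted sense.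
  (The constant \<open>AR\<close> of the library only compares subsets of Euclidean spaces.)
\<close>

definition absolute_retract :: "'r topology \<Rightarrow> bool" where
  "absolute_retract R \<longleftrightarrow>
     metrizable_space R \<and>
     (\<forall>(Y :: ('r \<Rightarrow> real) topology) e.
        metrizable_space Y \<and> embedding_map R Y e \<and> closedin Y (e ` topspace R)
        \<longrightarrow> (e ` topspace R) retract_of_space Y)"

text \<open>
  The absolute retract \<open>R\<close> ranges over topologies on the type \<open>'r\<close> and contains \<open>X\<close> through a closed
  embedding \<open>e\<close>. A space is not shape injective when the predicate fails for every type \<open>'r\<close>, so a
  negative result has to be stated with \<open>'r\<close> left as a type variable.
\<close>

definition pi1_shape_injective :: "'r itself \<Rightarrow> 'a topology \<Rightarrow> bool" where
  "pi1_shape_injective (_ :: 'r itself) X \<longleftrightarrow>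
     (\<exists>(R :: 'r topology) e.
        absolute_retract R \<and> embedding_map X R e \<and> closedin R (e ` topspace X) \<and>
        (\<forall>\<gamma>. essential X \<gamma> \<longrightarrow>
           (\<exists>U V. openin R U \<and> e ` topspace X \<subseteq> U \<and> U \<subseteq> V \<and> V \<subseteq> topspace R \<and>
                  essential (subtopology R V) (e \<circ> \<gamma>))))"

definition cyl :: "real \<Rightarrow> real \<Rightarrow> real \<Rightarrow> real^3" where
  "cyl r \<phi> z = vector [r * cos \<phi>, r * sin \<phi>, z]"

text \<open>
  The pieces of \<open>A\<close> are sets of coordinate triples \<open>(r, \<phi>, z)\<close> rather than of points of space:
  the triples with \<open>r = 0\<close> and different angles must stay distinct, because \<open>r \<mapsto> r0 - r\<close> turns them
  into different points of the outer annulus. Angles are real representatives modulo \<open>2 * pi\<close>.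
\<close>

definition sine_surface :: "real \<Rightarrow> (real \<times> real \<times> real) set" where
  "sine_surface r0 = {(r, \<phi>, z). 0 < r \<and> r \<le> r0 \<and> z = sin (1 / r)}"

definition limit_arc :: "(real \<times> real \<times> real) set" where
  "limit_arc = {(r, \<phi>, z). r = 0 \<and> - 1 \<le> z \<and> z \<le> 1}"

definition connecting_arc :: "real \<Rightarrow> real \<Rightarrow> (real \<times> real \<times> real) set" where
  "connecting_arc \<rho> \<theta> = {(r, \<phi>, z). 0 \<le> r \<and> r \<le> \<rho> \<and> \<phi> = \<theta> \<and> z = sin (1 / \<rho>)}"

definition space_A :: "real \<Rightarrow> (nat \<Rightarrow> real) \<Rightarrow> (nat \<Rightarrow> real) \<Rightarrow> (real \<times> real \<times> real) set" where
  "space_A r0 \<rho> \<theta> = sine_surface r0 \<union> limit_arc \<union> (\<Union>n\<in>{1..}. connecting_arc (\<rho> n) (\<theta> n))"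

definition space_B :: "real \<Rightarrow> (nat \<Rightarrow> real) \<Rightarrow> (nat \<Rightarrow> real) \<Rightarrow> (real^3) set" where
  "space_B r0 \<rho> \<theta> =
     {cyl (r0 - r) \<phi> z | r \<phi> z. (r, \<phi>, z) \<in> space_A r0 \<rho> \<theta> \<and> 0 \<le> r \<and> r \<le> r0}"

text \<open>
  Admissible data \<open>(\<rho> n, \<theta> n)\<close> for the connecting arcs. Density in
  \<open>(\<real> / 2\<pi>\<int>) \<times> [-1, 1]\<close> is expressed on the cylinder over the unit circle,
  identifying an angle \<open>t\<close> with \<open>cis t\<close>.
\<close>

definition arc_data :: "real \<Rightarrow> (nat \<Rightarrow> real) \<Rightarrow> (nat \<Rightarrow> real) \<Rightarrow> bool" where
  "arc_data r0 \<rho> \<theta> \<longleftrightarrow>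
     (\<forall>n\<ge>1. 0 < \<rho> n \<and> \<rho> n \<le> r0) \<and> \<rho> \<longlonglongrightarrow> 0 \<and>
     closure ((\<lambda>n. (cis (\<theta> n), sin (1 / \<rho> n))) ` {1..}) = sphere 0 1 \<times> {-1..1}"

end

theory Submission
  imports Defs
begin

text \<open>
  The witness is the circle at height \<open>0\<close> in the outer annulus. It is essential in \<open>B\<close>, but it
  contracts in every neighbourhood of \<open>B\<close> in every absolute retract containing \<open>B\<close>.

  Small in neighbourhoods: the sine surface crosses height \<open>0\<close> in circles that converge uniformly to
  the outer circle, and each of them bounds a disc in the surface. An absolute retract is
  equiconnected: any two points are joined by a path that depends continuously on them and is
  constant when they agree (\<open>absolute_retract_equiconnected\<close>). Hence sufficiently close loops are
  homotopic inside a prescribed neighbourhood, and the outer circle inherits the null homotopies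
  (\<open>inessential_limit_of_inessential\<close>).

  Essential in \<open>B\<close>: suppose \<open>F\<close> maps the disc to \<open>B\<close> and extends the outer circle. Let \<open>u\<close> be the
  horizontal part of \<open>F\<close>, a complex number, and \<open>h\<close> its height. Since \<open>u\<close> has winding number \<open>1\<close> on
  the boundary, it has zeros. At depth \<open>s\<close> below the outer annulus the space \<open>B\<close> consists of one
  circle, at height \<open>sin (1 / s)\<close>, and of finitely many points on connecting arcs. Choose depths
  decreasing to \<open>0\<close> at which the height of the circle is alternately \<open>1\<close> and \<open>- 1\<close>. For each depth
  take the component of the points of smaller depth that touches the boundary of the disc. The
  component of its complement that contains a given zero \<open>z\<close> is a hole with a connected frontier at
  exactly this depth, and \<open>F\<close> maps the frontier either into the circle or to a single point. Along a
  segment from \<open>z\<close> to the boundary of the disc, the last exit points from the holes, which grow as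
  the depth tends to \<open>0\<close>, converge, hence so do their heights; they cannot alternate
  between \<open>1\<close> and \<open>- 1\<close> for ever, so for some depth the whole frontier of the hole goes to one point
  (\<open>constant_on_frontier_of_some_hole\<close>). By compactness finitely many such holes cover the zeros, and
  replacing \<open>u\<close> on them by these nonzero constants turns \<open>u\<close> into a map without zeros
  (\<open>nonvanishing_modification\<close>). That is impossible, because the circle is not a retract of the disc.
\<close>

section \<open>Close loops in absolute retracts\<close>

text \<open>
  Embed \<open>R\<close> by \<open>x \<mapsto> d x _\<close>, for a bounded metric \<open>d\<close>, into the bounded real functions on \<open>R\<close> with the
  sup metric. As the surrounding space take the union of all straight segments between points of the
  image; it already contains the linear connecting paths, and the image is closed in it. A
  retraction onto the image carries the linear paths back to \<open>R\<close>.
\<close>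

lemma absolute_retract_equiconnected:
  fixes R :: "'r topology"
  assumes "absolute_retract R"
  obtains \<Lambda> where
    "continuous_map (prod_topology R (prod_topology R (top_of_set {0..1::real}))) R \<Lambda>"
    "\<And>x y. \<lbrakk>x \<in> topspace R; y \<in> topspace R\<rbrakk> \<Longrightarrow> \<Lambda> (x, y, 0) = x"
    "\<And>x y. \<lbrakk>x \<in> topspace R; y \<in> topspace R\<rbrakk> \<Longrightarrow> \<Lambda> (x, y, 1) = y"
    "\<And>x s. \<lbrakk>x \<in> topspace R; s \<in> {0..1}\<rbrakk> \<Longrightarrow> \<Lambda> (x, x, s) = x"
proof (cases "topspace R = {}")
  case True
  then have "topspace (prod_topology R (prod_topology R (top_of_set {0..1::real}))) = {}"
    by simp
  with True that show thesis
    by (metis continuous_map_on_empty empty_iff null_topspace_iff_trivial)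
next
  case False
  obtain M d0 where "Metric_space M d0" and R0: "R = Metric_space.mtopology M d0"
    using assms unfolding absolute_retract_def metrizable_space_def by blast
  define d where "d = Metric_space.capped_dist d0 1"
  interpret M: Metric_space M d
    unfolding d_def by (rule Metric_space.capped_dist) fact
  have R: "R = M.mtopology"
    unfolding d_def R0 by (simp add: Metric_space.mtopology_capped_metric \<open>Metric_space M d0\<close>)
  have d1: "d x y \<le> 1" for x y
    by (simp add: d_def Metric_space.capped_dist_def[OF \<open>Metric_space M d0\<close>])
  have dlip: "\<bar>d x u - d y u\<bar> \<le> d x y" if "x \<in> M" "y \<in> M" "u \<in> M" for x y u
    using M.triangle[of x y u] M.triangle[of y x u] that by (simp add: M.commute abs_le_iff)
  have ne: "M \<noteq> {}"
    using False R by simp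
  define seg where "seg = (\<lambda>x y s. restrict (\<lambda>u. (1 - s) * d x u + s * d y u) M)"
  define N where "N = {seg x y s | x y s. x \<in> M \<and> y \<in> M \<and> s \<in> {0..1::real}}"
  define D :: "('r \<Rightarrow> real) \<Rightarrow> ('r \<Rightarrow> real) \<Rightarrow> real" where "D = Met_TC.fdist M"
  have seg_fspace: "seg x y s \<in> Met_TC.fspace M" if "x \<in> M" "y \<in> M" "s \<in> {0..1}" for x y s
  proof -
    have "\<bar>(1 - s) * d x u + s * d y u\<bar> \<le> 1" for u
    proof -
      have "(1 - s) * d x u + s * d y u \<le> (1 - s) * 1 + s * 1"
        using that d1 by (intro add_mono mult_left_mono) auto
      moreover have "0 \<le> (1 - s) * d x u + s * d y u"
        using that by simp
      ultimately show ?thesis by simp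
    qed
    then have "bounded (seg x y s ` M)"
      unfolding bounded_iff seg_def by auto
    then show ?thesis
      by (simp add: Met_TC.fspace_def seg_def)
  qed
  have "Metric_space (Met_TC.fspace M) D"
    unfolding D_def by (rule Met_TC.Metric_space_funspace)
  then interpret N: Metric_space N D
    by (rule Metric_space.subspace) (auto simp: N_def seg_fspace)
  have D_le: "D f g \<le> a \<longleftrightarrow> (\<forall>u\<in>M. \<bar>f u - g u\<bar> \<le> a)" if "f \<in> N" "g \<in> N" for f g a
    unfolding D_def
    by (subst Met_TC.funspace_mdist_le) (use that ne seg_fspace in \<open>auto simp: N_def dist_real_def\<close>)
  have segN: "seg x y s \<in> N" if "x \<in> M" "y \<in> M" "s \<in> {0..1}" for x y s
    using that by (auto simp: N_def)
  have seg_app: "seg x y s u = (1 - s) * d x u + s * d y u" if "u \<in> M" for x y s u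
    using that by (simp add: seg_def)
  \<comment> \<open>This estimate makes the segment depend continuously on its end points and its parameter.\<close>
  have D_seg: "D (seg x y s) (seg x' y' s') \<le> d x x' + d y y' + \<bar>s - s'\<bar>"
    if "x \<in> M" "y \<in> M" "s \<in> {0..1}" "x' \<in> M" "y' \<in> M" "s' \<in> {0..1}" for x y s x' y' s'
  proof -
    have "\<bar>seg x y s u - seg x' y' s' u\<bar> \<le> d x x' + d y y' + \<bar>s - s'\<bar>" if u: "u \<in> M" for u
    proof -
      have "\<bar>(1 - s) * (d x u - d x' u)\<bar> \<le> 1 * d x x'"
        unfolding abs_mult using that \<open>x \<in> M\<close> \<open>x' \<in> M\<close> \<open>s \<in> _\<close> dlip by (intro mult_mono) auto
      moreover have "\<bar>s * (d y u - d y' u)\<bar> \<le> 1 * d y y'"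
        unfolding abs_mult using that \<open>y \<in> M\<close> \<open>y' \<in> M\<close> \<open>s \<in> _\<close> dlip by (intro mult_mono) auto
      moreover have "\<bar>(s - s') * (d y' u - d x' u)\<bar> \<le> \<bar>s - s'\<bar> * 1"
        unfolding abs_mult using d1[of y' u] d1[of x' u] M.nonneg[of y' u] M.nonneg[of x' u]
        by (intro mult_left_mono) (auto simp: abs_le_iff simp del: M.nonneg)
      moreover have "seg x y s u - seg x' y' s' u =
          (1 - s) * (d x u - d x' u) + s * (d y u - d y' u) + (s - s') * (d y' u - d x' u)"
        by (simp add: seg_app u algebra_simps)
      moreover have "\<bar>a + b + c\<bar> \<le> A + B + C" if "\<bar>a\<bar> \<le> A" "\<bar>b\<bar> \<le> B" "\<bar>c\<bar> \<le> C"
        for a b c A B C :: real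
        using that by linarith
      ultimately show ?thesis by simp
    qed
    then show ?thesis
      using D_le segN that by blast
  qed
  define \<iota> where "\<iota> = (\<lambda>x. seg x x 0)"
  have seg_diag: "seg x x s = \<iota> x" for x s
    by (auto simp: \<iota>_def seg_def algebra_simps)
  have seg_0: "seg x y 0 = \<iota> x" and seg_1: "seg x y 1 = \<iota> y" for x y
    by (auto simp: \<iota>_def seg_def)
  have \<iota>N: "\<iota> x \<in> N" if "x \<in> M" for x
    using that by (simp add: \<iota>_def segN)
  have \<iota>_app: "\<iota> x u = d x u" if "u \<in> M" for x u
    using that by (simp add: \<iota>_def seg_app)
  have \<iota>_iso: "D (\<iota> x) (\<iota> y) = d x y" if "x \<in> M" "y \<in> M" for x y
  proof (rule antisym)
    show "D (\<iota> x) (\<iota> y) \<le> d x y"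
      using that \<iota>N dlip by (simp add: D_le \<iota>_app)
    show "d x y \<le> D (\<iota> x) (\<iota> y)"
      using D_le[OF \<iota>N[OF that(1)] \<iota>N[OF that(2)], of "D (\<iota> x) (\<iota> y)"] that
      by (auto simp: \<iota>_app dest!: bspec[of _ _ y])
  qed
  interpret MN: Metric_space12 M d N D ..
  have emb: "embedding_map R N.mtopology \<iota>"
    unfolding R by (rule MN.isometry_imp_embedding_map) (auto simp: \<iota>N \<iota>_iso)
  have closed: "closedin N.mtopology (\<iota> ` topspace R)"
    unfolding N.closedin_metric
  proof (intro conjI allI impI)
    show "\<iota> ` topspace R \<subseteq> N"
      using \<iota>N by (auto simp: R)
    fix f assume f: "f \<in> N - \<iota> ` topspace R"
    then obtain x y s where xys: "x \<in> M" "y \<in> M" "s \<in> {0..1}" and f_eq: "f = seg x y s"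
      by (auto simp: N_def)
    \<comment> \<open>If \<open>\<iota> v\<close> is near \<open>f\<close>, then \<open>f v\<close> is near \<open>d v v = 0\<close>, so \<open>v\<close> is near
      the end point \<open>w\<close> with the larger weight, and \<open>f\<close> is near \<open>\<iota> w\<close>.\<close>
    define w where "w = (if s \<le> 1/2 then x else y)"
    have wM: "w \<in> M"
      using xys by (simp add: w_def)
    have pos: "0 < D f (\<iota> w)"
      using f wM \<iota>N N.mdist_pos_less[of f "\<iota> w"] by (auto simp: R)
    have "disjnt (\<iota> ` topspace R) (N.mball f (D f (\<iota> w) / 3))"
      unfolding disjnt_iff
    proof (intro allI notI)
      fix g assume g: "g \<in> \<iota> ` topspace R \<and> g \<in> N.mball f (D f (\<iota> w) / 3)"
      then obtain v where v: "v \<in> M" and g_eq: "g = \<iota> v" and lt: "D f (\<iota> v) < D f (\<iota> w) / 3"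
        by (auto simp: R)
      have "\<bar>f v - \<iota> v v\<bar> \<le> D f (\<iota> v)"
        using D_le[of f "\<iota> v" "D f (\<iota> v)"] v f \<iota>N by auto
      then have "(1 - s) * d x v + s * d y v \<le> D f (\<iota> v)"
        using v by (simp add: \<iota>_app f_eq seg_app)
      moreover have "1/2 * d w v \<le> (1 - s) * d x v + s * d y v"
      proof (cases "s \<le> 1/2")
        case True
        then have "1/2 * d x v \<le> (1 - s) * d x v" "0 \<le> s * d y v"
          using xys mult_right_mono[of "1/2" "1 - s" "d x v"] by auto
        then show ?thesis using True by (simp add: w_def)
      next
        case False
        then have "1/2 * d y v \<le> s * d y v" "0 \<le> (1 - s) * d x v"
          using xys mult_right_mono[of "1/2" s "d y v"] by auto
        then show ?thesis using False by (simp add: w_def)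
      qed
      moreover have "D f (\<iota> w) \<le> D f (\<iota> v) + d w v"
        using N.triangle[of f "\<iota> v" "\<iota> w"] f \<iota>N v wM \<iota>_iso[OF v wM] by (simp add: M.commute)
      ultimately show False
        using lt by linarith
    qed
    then show "\<exists>r>0. disjnt (\<iota> ` topspace R) (N.mball f r)"
      using pos by (intro exI[of _ "D f (\<iota> w) / 3"]) simp
  qed
  have "(\<iota> ` topspace R) retract_of_space N.mtopology"
    using assms emb closed N.metrizable_space_mtopology unfolding absolute_retract_def by blast
  then obtain r where r: "continuous_map N.mtopology (subtopology N.mtopology (\<iota> ` topspace R)) r"
      and r_id: "\<And>f. f \<in> \<iota> ` topspace R \<Longrightarrow> r f = f"
    unfolding retract_of_space_def by blast
  obtain j where j: "homeomorphic_maps R (subtopology N.mtopology (\<iota> ` topspace R)) \<iota> j"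
    using emb unfolding embedding_map_def homeomorphic_map_maps by blast
  have jr: "continuous_map N.mtopology R (j \<circ> r)"
    using continuous_map_compose[OF r] j unfolding homeomorphic_maps_def by blast
  have jr\<iota>: "(j \<circ> r) (\<iota> x) = x" if "x \<in> topspace R" for x
    using that r_id j unfolding homeomorphic_maps_def by simp
  have cont_seg: "continuous_map (prod_topology R (prod_topology R (top_of_set {0..1::real})))
      N.mtopology (\<lambda>(x, y, s). seg x y s)"
    unfolding N.continuous_map_to_metric
  proof (intro ballI allI impI)
    fix p and \<epsilon> :: real
    assume p: "p \<in> topspace (prod_topology R (prod_topology R (top_of_set {0..1::real})))" and \<epsilon>: "0 < \<epsilon>"
    obtain x y s where p_eq: "p = (x, y, s)" and xys: "x \<in> M" "y \<in> M" "s \<in> {0..1}"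
      using p by (auto simp: R)
    let ?U = "M.mball x (\<epsilon>/3) \<times> M.mball y (\<epsilon>/3) \<times> ({0..1} \<inter> ball s (\<epsilon>/3))"
    have "openin (prod_topology R (prod_topology R (top_of_set {0..1::real}))) ?U"
      by (simp add: R openin_prod_Times_iff openin_open_Int)
    moreover have "p \<in> ?U"
      using xys \<epsilon> by (simp add: p_eq)
    moreover have "(case q of (x, y, s) \<Rightarrow> seg x y s) \<in> N.mball (case p of (x, y, s) \<Rightarrow> seg x y s) \<epsilon>"
      if "q \<in> ?U" for q
    proof -
      obtain x' y' s' where q: "q = (x', y', s')" "x' \<in> M" "y' \<in> M" "s' \<in> {0..1}"
        "d x x' < \<epsilon>/3" "d y y' < \<epsilon>/3" "\<bar>s - s'\<bar> < \<epsilon>/3"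
        using \<open>q \<in> ?U\<close> by (auto simp: dist_real_def)
      have "D (seg x y s) (seg x' y' s') < \<epsilon>"
        using D_seg[of x y s x' y' s'] xys q by linarith
      then show ?thesis
        using xys q segN by (simp add: p_eq)
    qed
    ultimately show "\<exists>U. openin (prod_topology R (prod_topology R (top_of_set {0..1::real}))) U \<and> p \<in> U \<and>
        (\<forall>q\<in>U. (case q of (x, y, s) \<Rightarrow> seg x y s) \<in> N.mball (case p of (x, y, s) \<Rightarrow> seg x y s) \<epsilon>)"
      by blast
  qed
  show thesis
  proof (rule that[of "(j \<circ> r) \<circ> (\<lambda>(x, y, s). seg x y s)"])
    show "continuous_map (prod_topology R (prod_topology R (top_of_set {0..1::real}))) R
        ((j \<circ> r) \<circ> (\<lambda>(x, y, s). seg x y s))"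
      by (rule continuous_map_compose[OF cont_seg jr])
  qed (use jr\<iota> in \<open>simp_all add: seg_diag seg_0 seg_1\<close>)
qed

text \<open>
  The connecting paths of \<open>R\<close> give a homotopy \<open>\<Theta>\<close> on pairs of points of \<open>B\<close> that is constant on the
  diagonal. Over the compact image of \<open>\<gamma>\<close> in the diagonal it lies in \<open>U\<close>, so it stays in \<open>U\<close> for pairs
  that are uniformly close. The null homotopy of \<open>e \<circ> \<gamma>\<close> runs a filling of a nearby loop on the
  inner half of the disc and \<open>\<Theta>\<close> on the outer collar.
\<close>

lemma inessential_limit_of_inessential:
  fixes B :: "'b::metric_space set"
  assumes R: "absolute_retract R"
    and e: "continuous_map (top_of_set B) R e"
    and U: "openin R U" "e ` B \<subseteq> U"
    and \<gamma>: "loop_in (top_of_set B) \<gamma>"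
    and approx: "\<And>\<epsilon>. 0 < \<epsilon> \<Longrightarrow> \<exists>\<gamma>'. inessential (top_of_set B) \<gamma>' \<and>
      (\<forall>x\<in>sphere 0 1. dist (\<gamma> x) (\<gamma>' x) < \<epsilon>)"
  shows "inessential (subtopology R U) (e \<circ> \<gamma>)"
proof -
  obtain \<Lambda> where \<Lambda>: "continuous_map (prod_topology R (prod_topology R (top_of_set {0..1::real}))) R \<Lambda>"
    and \<Lambda>0: "\<And>x y. \<lbrakk>x \<in> topspace R; y \<in> topspace R\<rbrakk> \<Longrightarrow> \<Lambda> (x, y, 0) = x"
    and \<Lambda>1: "\<And>x y. \<lbrakk>x \<in> topspace R; y \<in> topspace R\<rbrakk> \<Longrightarrow> \<Lambda> (x, y, 1) = y"
    and \<Lambda>d: "\<And>x s. \<lbrakk>x \<in> topspace R; s \<in> {0..1}\<rbrakk> \<Longrightarrow> \<Lambda> (x, x, s) = x"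
    by (rule absolute_retract_equiconnected[OF R], rule that) (assumption | blast)+
  have eR: "e a \<in> topspace R" if "a \<in> B" for a
    using e that by (auto simp: continuous_map_def)
  have \<gamma>_cont: "continuous_on (sphere 0 1) \<gamma>"
    using \<gamma> by (simp add: loop_in_def)
  have \<gamma>B: "\<gamma> x \<in> B" if "x \<in> sphere 0 1" for x
    using \<gamma> that by (auto simp: loop_in_def)
  define \<Theta> where "\<Theta> = (\<lambda>(a, b, s). \<Lambda> (e a, e b, s))"
  have \<Theta>: "continuous_map (top_of_set (B \<times> B \<times> {0..1})) R \<Theta>"
  proof -
    have "continuous_map (top_of_set (B \<times> B \<times> {0..1::real})) (top_of_set B) fst"
      "continuous_map (top_of_set (B \<times> B \<times> {0..1::real})) (top_of_set B) (fst \<circ> snd)"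
      "continuous_map (top_of_set (B \<times> B \<times> {0..1::real})) (top_of_set {0..1}) (snd \<circ> snd)"
      by (auto intro!: continuous_intros continuous_on_compose2[OF continuous_on_fst[OF continuous_on_id]]
            continuous_on_compose2[OF continuous_on_snd[OF continuous_on_id]] simp: o_def)
    then have "continuous_map (top_of_set (B \<times> B \<times> {0..1}))
        (prod_topology R (prod_topology R (top_of_set {0..1::real})))
        (\<lambda>p. ((e \<circ> fst) p, (e \<circ> (fst \<circ> snd)) p, (snd \<circ> snd) p))"
      by (intro continuous_map_pairedI continuous_map_compose[OF _ e]) (auto intro: continuous_map_compose)
    from continuous_map_compose[OF this \<Lambda>] show ?thesis
      by (simp add: \<Theta>_def o_def case_prod_unfold)
  qed
  define T where "T = {p \<in> B \<times> B \<times> {0..1}. \<Theta> p \<in> U}"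
  have "openin (top_of_set (B \<times> B \<times> {0..1})) T"
    using openin_continuous_map_preimage[OF \<Theta> U(1)] by (simp add: T_def)
  then obtain T' where T': "open T'" "T = B \<times> B \<times> {0..1} \<inter> T'"
    by (auto simp: openin_open)
  define K where "K = (\<lambda>(x, s). (\<gamma> x, \<gamma> x, s)) ` (sphere 0 1 \<times> {0..1::real})"
  have "compact K"
    unfolding K_def case_prod_unfold
    by (intro compact_continuous_image compact_Times compact_sphere compact_Icc continuous_intros
        continuous_on_compose2[OF \<gamma>_cont]) auto
  moreover have "K \<subseteq> T"
    using \<gamma>B \<Lambda>d eR U(2) by (auto simp: K_def T_def \<Theta>_def)
  ultimately obtain \<epsilon> where \<epsilon>: "0 < \<epsilon>" "(\<Union>p\<in>K. ball p \<epsilon>) \<subseteq> T'"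
    using T' compact_subset_open_imp_ball_epsilon_subset[of K T'] by blast
  obtain \<gamma>' G where near: "\<And>x. x \<in> sphere 0 1 \<Longrightarrow> dist (\<gamma> x) (\<gamma>' x) < \<epsilon>"
    and G: "continuous_map (top_of_set (cball 0 1)) (top_of_set B) G"
    and G\<gamma>': "\<And>x. x \<in> sphere 0 1 \<Longrightarrow> G x = \<gamma>' x"
    using approx[OF \<epsilon>(1)] unfolding inessential_def by blast
  have \<gamma>'B: "\<gamma>' x \<in> B" if "x \<in> sphere 0 1" for x
    using G G\<gamma>'[OF that, symmetric] that by (auto simp: continuous_map_in_subtopology Pi_iff)
  have \<Theta>U: "\<Theta> (\<gamma>' x, \<gamma> x, s) \<in> U" if "x \<in> sphere 0 1" "s \<in> {0..1}" for x s
  proof -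
    have "(\<gamma> x, \<gamma> x, s) \<in> K"
      using that by (force simp: K_def)
    moreover have "(\<gamma>' x, \<gamma> x, s) \<in> ball (\<gamma> x, \<gamma> x, s) \<epsilon>"
      using near[OF that(1)] by (simp add: dist_Pair_Pair)
    ultimately have "(\<gamma>' x, \<gamma> x, s) \<in> T'"
      using \<epsilon>(2) by blast
    then have "(\<gamma>' x, \<gamma> x, s) \<in> T"
      using T'(2) \<gamma>B \<gamma>'B that by auto
    then show ?thesis by (simp add: T_def)
  qed
  define dir where "dir = (\<lambda>x::complex. x /\<^sub>R norm x)"
  define inner where "inner = (\<lambda>x. e (G (2 *\<^sub>R x)))"
  define outer where "outer = (\<lambda>x. \<Theta> (\<gamma>' (dir x), \<gamma> (dir x), 2 * norm x - 1))"
  define F where "F = (\<lambda>x. if norm x \<le> 1/2 then inner x else outer x)"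
  have dir: "dir x \<in> sphere 0 1" if "1/2 \<le> norm x" for x
  proof -
    have "norm x \<noteq> 0" using that by linarith
    then show ?thesis by (auto simp: dir_def)
  qed
  have "continuous_map (top_of_set (cball 0 1)) (subtopology R U) F"
    unfolding F_def
  proof (rule continuous_map_cases_le)
    show "continuous_map (top_of_set (cball 0 1)) euclideanreal norm"
      by (simp add: continuous_on_norm)
    have sub: "subtopology (top_of_set (cball 0 1)) {x \<in> topspace (top_of_set (cball 0 1)). norm x \<le> 1/2}
        = top_of_set (cball (0::complex) (1/2))"
      by (auto simp: subtopology_subtopology intro!: arg_cong[of _ _ "subtopology _"])
    have "continuous_map (top_of_set (cball 0 (1/2))) (top_of_set B) (G \<circ> (\<lambda>x. 2 *\<^sub>R x))"
      by (rule continuous_map_compose[OF _ G]) (auto intro!: continuous_intros)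
    from continuous_map_compose[OF this e]
    have "continuous_map (top_of_set (cball 0 (1/2))) R inner"
      by (simp add: inner_def o_def)
    moreover have "inner x \<in> U" if "x \<in> cball 0 (1/2)" for x
    proof -
      have "G (2 *\<^sub>R x) \<in> B"
        using G that by (auto simp: continuous_map_in_subtopology Pi_iff)
      then show ?thesis
        using U(2) by (auto simp: inner_def)
    qed
    ultimately show "continuous_map (subtopology (top_of_set (cball 0 1))
        {x \<in> topspace (top_of_set (cball 0 1)). norm x \<le> 1/2}) (subtopology R U) inner"
      unfolding sub by (auto simp: continuous_map_in_subtopology)
    have sub': "subtopology (top_of_set (cball 0 1)) {x \<in> topspace (top_of_set (cball 0 1)). 1/2 \<le> norm x}
        = top_of_set {x :: complex. 1/2 \<le> norm x \<and> norm x \<le> 1}"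
      by (auto simp: subtopology_subtopology intro!: arg_cong[of _ _ "subtopology _"])
    let ?A = "{x :: complex. 1/2 \<le> norm x \<and> norm x \<le> 1}"
    have "continuous_on ?A dir"
      unfolding dir_def by (auto intro!: continuous_intros)
    moreover have "continuous_on (sphere 0 1) \<gamma>'"
      using G by (auto simp: G\<gamma>' intro: continuous_on_eq[OF continuous_on_subset])
    moreover have "dir ` ?A \<subseteq> sphere 0 1"
      using dir by blast
    ultimately have "continuous_on ?A (\<lambda>x. \<gamma>' (dir x))" "continuous_on ?A (\<lambda>x. \<gamma> (dir x))"
      using continuous_on_compose2 \<gamma>_cont by blast+
    then have "continuous_on ?A (\<lambda>x. (\<gamma>' (dir x), \<gamma> (dir x), 2 * norm x - 1))"
      by (intro continuous_intros)
    then have "continuous_map (top_of_set ?A) (top_of_set (B \<times> B \<times> {0..1}))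
        (\<lambda>x. (\<gamma>' (dir x), \<gamma> (dir x), 2 * norm x - 1))"
      using \<gamma>B \<gamma>'B dir by auto
    from continuous_map_compose[OF this \<Theta>]
    have "continuous_map (top_of_set ?A) R outer"
      by (simp add: outer_def o_def)
    moreover have "outer x \<in> U" if "x \<in> ?A" for x
      using that dir[of x] unfolding outer_def by (intro \<Theta>U) auto
    ultimately show "continuous_map (subtopology (top_of_set (cball 0 1))
        {x \<in> topspace (top_of_set (cball 0 1)). 1/2 \<le> norm x}) (subtopology R U) outer"
      unfolding sub' by (auto simp: continuous_map_in_subtopology)
  next
    fix x :: complex assume half: "norm x = 1/2"
    have two: "dir x = 2 *\<^sub>R x"
      unfolding dir_def half by simp
    have "dir x \<in> sphere 0 1"
      using dir[of x] half by simp
    then have in_B: "\<gamma> (dir x) \<in> B" "\<gamma>' (dir x) \<in> B" and eq: "G (dir x) = \<gamma>' (dir x)"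
      using \<gamma>B \<gamma>'B G\<gamma>' by auto
    have "outer x = \<Lambda> (e (\<gamma>' (dir x)), e (\<gamma> (dir x)), 0)"
      by (simp add: outer_def \<Theta>_def half)
    also have "\<dots> = e (\<gamma>' (dir x))"
      using in_B eR by (intro \<Lambda>0) auto
    also have "\<dots> = inner x"
      by (simp add: inner_def eq flip: two)
    finally show "inner x = outer x" ..
  qed simp
  moreover have "F x = (e \<circ> \<gamma>) x" if "x \<in> sphere 0 1" for x
    using that \<gamma>B[of x] \<gamma>'B[of x]
    by (auto simp: F_def outer_def dir_def \<Theta>_def \<Lambda>1 eR continuous_map_in_subtopology)
  ultimately show ?thesis
    unfolding inessential_def by blast
qed

section \<open>Removing the zeros of a plane map\<close>

text \<open>
  Gluing along frontiers: on the frontier of each of the sets the old map and the new constant agree.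
\<close>

lemma continuous_constant_on_closed_sets:
  fixes u :: "'a::topological_space \<Rightarrow> 'b::topological_space"
  assumes "finite \<F>" and "continuous_on UNIV u"
    and "\<And>H. H \<in> \<F> \<Longrightarrow> closed H" and "pairwise disjnt \<F>"
    and "\<And>H x. \<lbrakk>H \<in> \<F>; x \<in> frontier H\<rbrakk> \<Longrightarrow> u x = c H"
  shows "\<exists>v. continuous_on UNIV v \<and> (\<forall>x. x \<notin> \<Union>\<F> \<longrightarrow> v x = u x) \<and> (\<forall>H\<in>\<F>. \<forall>x\<in>H. v x = c H)"
  using assms
proof (induction \<F> rule: finite_induct)
  case empty
  then show ?case by auto
next
  case (insert H \<F>)
  then obtain v where v: "continuous_on UNIV v" "\<And>x. x \<notin> \<Union>\<F> \<Longrightarrow> v x = u x"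
      "\<And>K x. \<lbrakk>K \<in> \<F>; x \<in> K\<rbrakk> \<Longrightarrow> v x = c K"
    by (force simp: pairwise_insert)
  have dis: "x \<notin> K" if "K \<in> \<F>" "x \<in> H" for x K
    using insert.hyps insert.prems(3) that by (auto simp: pairwise_insert disjnt_iff)
  have "closed H"
    using insert.prems by blast
  have "v x = c H" if "x \<in> H" "x \<in> closure (- H)" for x
  proof -
    have "x \<in> frontier H"
      using that \<open>closed H\<close> by (simp add: frontier_closures)
    then show ?thesis
      using insert.prems(4)[of H x] v(2)[of x] dis that by auto
  qed
  then have "continuous_on (H \<union> closure (- H)) (\<lambda>x. if x \<in> H then c H else v x)"
    using \<open>closed H\<close> v(1) closure_subset
    by (intro continuous_on_cases) (auto intro: continuous_on_subset)
  moreover have "H \<union> closure (- H) = UNIV"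
    using closure_subset by blast
  ultimately show ?case
    using v dis by (intro exI[of _ "\<lambda>x. if x \<in> H then c H else v x"]) auto
qed

text \<open>
  For the maps \<open>u\<close> considered here, \<open>norm (u x)\<close> is the constant \<open>r0\<close> outside the unit disc, and the
  region is meant for \<open>t < r0\<close>; it then contains this whole exterior, of which \<open>1\<close> is just a
  convenient point.
\<close>

definition outer_region :: "(complex \<Rightarrow> complex) \<Rightarrow> real \<Rightarrow> complex set" where
  "outer_region u t = connected_component_set {x. t < norm (u x)} 1"

definition hole :: "(complex \<Rightarrow> complex) \<Rightarrow> real \<Rightarrow> complex \<Rightarrow> complex set" where
  "hole u t z = connected_component_set (- outer_region u t) z"

context
  fixes u :: "complex \<Rightarrow> complex" and r0 :: real
  assumes u_cont: "continuous_on UNIV u"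
    and u_outside: "\<And>x. 1 \<le> norm x \<Longrightarrow> norm (u x) = r0"
begin

lemma open_outer_region: "open (outer_region u t)"
  unfolding outer_region_def
  by (intro open_connected_component open_Collect_less continuous_intros continuous_on_subset[OF u_cont]) auto

lemma connected_outer_region: "connected (outer_region u t)"
  by (simp add: outer_region_def)

lemma outer_region_antimono: "s \<le> t \<Longrightarrow> outer_region u t \<subseteq> outer_region u s"
  unfolding outer_region_def by (intro connected_component_mono) auto

lemma connected_outside_ball: "connected {x::complex. 1 \<le> norm x}"
proof -
  have "connected (- ball (0::complex) 1)"
    by (rule connected_complement_bounded_convex) auto
  moreover have "- ball (0::complex) 1 = {x. 1 \<le> norm x}"
    by auto
  ultimately show ?thesis by simp
qed

lemma outside_subset_outer_region:
  assumes "t < r0" shows "{x. 1 \<le> norm x} \<subseteq> outer_region u t"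
  unfolding outer_region_def
  using assms u_outside connected_outside_ball by (intro connected_component_maximal) auto

lemma hole_subset_ball:
  assumes "t < r0" shows "hole u t z \<subseteq> ball 0 1"
proof
  fix x assume "x \<in> hole u t z"
  then have "x \<notin> outer_region u t"
    using connected_component_subset[of "- outer_region u t" z] by (auto simp: hole_def)
  then have "\<not> 1 \<le> norm x"
    using outside_subset_outer_region[OF assms] by blast
  then show "x \<in> ball 0 1"
    by simp
qed

lemma closed_hole: "closed (hole u t z)"
  unfolding hole_def by (intro closed_connected_component) (simp add: open_outer_region closed_Compl)

text \<open>
  The plane is unicoherent: a component of the complement of a connected set has a connected frontier.
\<close>

lemma connected_frontier_hole: "connected (frontier (hole u t z))"
proof (cases "z \<in> outer_region u t")
  case True
  then have "hole u t z = {}"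
    unfolding hole_def by (subst connected_component_eq_empty) simp
  then show ?thesis by simp
next
  case False
  then have "hole u t z \<in> components (- outer_region u t)"
    by (auto simp: hole_def components_def)
  then show ?thesis
    by (rule connected_frontier_component_complement[OF connected_outer_region])
qed

lemma frontier_hole_level:
  assumes "x \<in> frontier (hole u t z)" shows "norm (u x) = t"
proof -
  have "frontier (hole u t z) \<subseteq> frontier (- outer_region u t)"
    unfolding hole_def by (rule frontier_of_connected_component_subset)
  also have "\<dots> = frontier (outer_region u t)"
    by simp
  also have "\<dots> \<subseteq> frontier {x. t < norm (u x)}"
    unfolding outer_region_def by (rule frontier_of_connected_component_subset)
  also have "\<dots> \<subseteq> {x. t = norm (u x)}"
  proof -
    have 1: "open {x. t < norm (u x)}" and 2: "closed {x. t \<le> norm (u x)}"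
      by (intro open_Collect_less closed_Collect_le continuous_intros continuous_on_subset[OF u_cont]; simp)+
    have "closure {x. t < norm (u x)} \<subseteq> {x. t \<le> norm (u x)}"
      using 2 by (intro closure_minimal) auto
    then show ?thesis
      using 1 by (auto simp: frontier_def interior_open)
  qed
  finally show ?thesis
    using assms by auto
qed

lemma zero_in_interior_hole:
  assumes "u z = 0" "0 < t" shows "z \<in> interior (hole u t z)"
proof -
  have "open {x. norm (u x) < t}"
    by (intro open_Collect_less continuous_intros continuous_on_subset[OF u_cont]) auto
  then obtain e where e: "0 < e" "ball z e \<subseteq> {x. norm (u x) < t}"
    using assms by (metis (mono_tags, lifting) mem_Collect_eq norm_zero open_contains_ball)
  have "outer_region u t \<subseteq> {x. t < norm (u x)}"
    unfolding outer_region_def by (rule connected_component_subset)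
  then have "ball z e \<subseteq> hole u t z"
    unfolding hole_def using e by (intro connected_component_maximal) (auto, fastforce)
  then show ?thesis
    using e(1) by (auto simp: mem_interior)
qed

text \<open>
  The outer region shrinks as the level grows, so a hole of lower level avoids the outer region of
  higher level and, being connected, lies in a single hole of that level.
\<close>

lemma hole_nested_or_disjoint:
  assumes "s \<le> t"
  shows "hole u s z \<subseteq> hole u t w \<or> disjnt (hole u s z) (hole u t w)"
proof (cases "disjnt (hole u s z) (hole u t w)")
  case False
  then obtain x where x: "x \<in> hole u s z" "x \<in> hole u t w"
    by (auto simp: disjnt_iff)
  have "hole u s z \<subseteq> - outer_region u t"
    using outer_region_antimono[OF assms] connected_component_subset[of "- outer_region u s" z]
    by (auto simp: hole_def)
  then have "hole u s z \<subseteq> connected_component_set (- outer_region u t) x"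
    using x(1) by (intro connected_component_maximal) (auto simp: hole_def)
  also have "\<dots> = hole u t w"
    using x(2) unfolding hole_def by (metis connected_component_eq)
  finally show ?thesis ..
qed simp

lemma hole_mono:
  assumes "s \<le> t" "u z = 0" "0 < s" shows "hole u s z \<subseteq> hole u t z"
proof -
  have "z \<in> hole u s z" "z \<in> hole u t z"
    using zero_in_interior_hole[of z s] zero_in_interior_hole[of z t] assms interior_subset by auto
  then show ?thesis
    using hole_nested_or_disjoint[OF assms(1), of z z] by (auto simp: disjnt_iff)
qed

text \<open>
  On the level \<open>t p\<close> the pair \<open>(u, h)\<close> lies on the plane of height \<open>(- 1) ^ p\<close> or in a finite set. A
  connected set that contains one of the finitely many points off that plane maps to this point
  only, so it is enough to find one such point on one frontier. The points at which a fixed segment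
  leaves the holes for the last time provide it, since their heights converge.
\<close>

lemma constant_on_frontier_of_some_hole:
  fixes h :: "complex \<Rightarrow> real" and t :: "nat \<Rightarrow> real"
  assumes h_cont: "continuous_on UNIV h"
    and t: "incseq t" "\<And>p. 0 < t p" "\<And>p. t p < r0"
    and level: "\<And>p x. norm (u x) = t p \<Longrightarrow> h x = (- 1) ^ p \<or> (u x, h x) \<in> S p"
    and fin: "\<And>p. finite (S p)"
    and z: "u z = 0"
  shows "\<exists>p. u constant_on frontier (hole u (t p) z)"
proof -
  define b where "b = (\<lambda>s. z + of_real s * (1 - z))"
  have b_cont: "continuous_on UNIV b"
    unfolding b_def by (intro continuous_intros)
  define T where "T = (\<lambda>p. {s \<in> {0..1}. b s \<in> hole u (t p) z})"
  have z_hole: "z \<in> hole u (t p) z" for p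
    using zero_in_interior_hole[OF z t(2)] interior_subset by blast
  have T_compact: "compact (T p)" for p
  proof -
    have "closed (b -` hole u (t p) z)"
      by (rule continuous_closed_vimage[OF closed_hole]) (use b_cont in \<open>simp add: continuous_on_eq_continuous_at\<close>)
    then have "compact ({0..1} \<inter> b -` hole u (t p) z)"
      by (intro compact_Int_closed) auto
    moreover have "{0..1} \<inter> b -` hole u (t p) z = T p"
      by (auto simp: T_def)
    ultimately show ?thesis by simp
  qed
  have T_ne: "0 \<in> T p" for p
    using z_hole by (simp add: T_def b_def)
  \<comment> \<open>The last parameter at which the segment \<open>b\<close> from \<open>z\<close> to \<open>1\<close> is in the hole;
    as the holes grow with \<open>p\<close>, these parameters increase.\<close>
  define \<tau> where "\<tau> = (\<lambda>p. Sup (T p))"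
  have \<tau>_in: "\<tau> p \<in> T p" for p
    unfolding \<tau>_def using T_compact[of p] T_ne[of p]
    by (intro closed_contains_Sup) (auto simp: compact_imp_closed bounded_imp_bdd_above compact_imp_bounded)
  have \<tau>_max: "s \<le> \<tau> p" if "s \<in> T p" for s p
    unfolding \<tau>_def using T_compact[of p] that
    by (intro cSup_upper) (auto simp: bounded_imp_bdd_above compact_imp_bounded)
  have "incseq \<tau>"
  proof (rule incseq_SucI)
    fix p
    have "hole u (t p) z \<subseteq> hole u (t (Suc p)) z"
      using t z by (intro hole_mono) (auto simp: incseq_Suc_iff)
    then show "\<tau> p \<le> \<tau> (Suc p)"
      using \<tau>_in[of p] by (intro \<tau>_max) (auto simp: T_def)
  qed
  moreover have "\<tau> p \<le> 1" for p
    using \<tau>_in[of p] by (simp add: T_def)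
  ultimately obtain l where l: "\<tau> \<longlonglongrightarrow> l"
    using incseq_convergent by blast
  have lim: "(\<lambda>p. h (b (\<tau> p))) \<longlonglongrightarrow> h (b l)"
    using l h_cont b_cont
    by (intro continuous_on_tendsto_compose[OF h_cont] continuous_on_tendsto_compose[OF b_cont]) auto
  have \<tau>_frontier: "b (\<tau> p) \<in> frontier (hole u (t p) z)" for p
  proof (rule ccontr)
    assume "b (\<tau> p) \<notin> frontier (hole u (t p) z)"
    then have "b (\<tau> p) \<in> interior (hole u (t p) z)"
      using \<tau>_in[of p] closure_subset by (auto simp: frontier_def T_def)
    moreover have "b 1 \<notin> hole u (t p) z"
      using hole_subset_ball[OF t(3)[of p], of z] by (auto simp: b_def)
    then have "\<tau> p \<noteq> 1"
      using \<tau>_in[of p] by (auto simp: T_def)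
    then have "\<tau> p < 1"
      using \<open>\<And>p. \<tau> p \<le> 1\<close> by (simp add: less_le)
    moreover have "open (b -` interior (hole u (t p) z))"
      using open_vimage[OF open_interior b_cont] .
    ultimately obtain d where d: "0 < d" "ball (\<tau> p) d \<subseteq> b -` interior (hole u (t p) z)"
      by (metis open_contains_ball vimageI2)
    define s where "s = min 1 (\<tau> p + d/2)"
    have "\<tau> p < s" "s \<le> 1" "\<bar>s - \<tau> p\<bar> < d"
      using d(1) \<open>\<tau> p < 1\<close> by (auto simp: s_def min_def)
    moreover have "0 \<le> \<tau> p"
      using \<tau>_in[of p] by (simp add: T_def)
    ultimately have "s \<in> T p"
      using subsetD[OF d(2), of s] interior_subset by (auto simp: T_def dist_real_def)
    then show False
      using \<tau>_max \<open>\<tau> p < s\<close> by fastforce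
  qed
  have "\<exists>p. h (b (\<tau> p)) \<noteq> (- 1) ^ p"
  proof (rule ccontr)
    assume "\<not> ?thesis"
    then have *: "(\<lambda>p. (- 1) ^ p :: real) \<longlonglongrightarrow> h (b l)"
      using lim by simp
    have "(\<lambda>p. (- 1) ^ (2 * p) :: real) \<longlonglongrightarrow> h (b l)" "(\<lambda>p. (- 1) ^ (2 * p + 1) :: real) \<longlonglongrightarrow> h (b l)"
      using LIMSEQ_subseq_LIMSEQ[OF *, of "\<lambda>p. 2 * p"] LIMSEQ_subseq_LIMSEQ[OF *, of "\<lambda>p. 2 * p + 1"]
      by (auto simp: o_def strict_mono_def)
    then have "h (b l) = 1" "h (b l) = - 1"
      by (auto simp: LIMSEQ_const_iff)
    then show False by simp
  qed
  then obtain p where p: "h (b (\<tau> p)) \<noteq> (- 1) ^ p" ..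
  let ?H = "frontier (hole u (t p) z)"
  define f where "f = (\<lambda>x. (u x, h x))"
  define C :: "(complex \<times> real) set" where "C = UNIV \<times> {(- 1) ^ p}"
  define q where "q = f (b (\<tau> p))"
  have "continuous_on ?H f"
    unfolding f_def by (intro continuous_intros continuous_on_subset[OF u_cont] continuous_on_subset[OF h_cont]) auto
  then have "connected (f ` ?H)"
    by (rule connected_continuous_image) (rule connected_frontier_hole)
  \<comment> \<open>Here \<open>q\<close> is isolated from the rest of the possible values.\<close>
  moreover have sub: "f ` ?H \<subseteq> {q} \<union> ((S p - {q}) \<union> C)"
    using level frontier_hole_level by (fastforce simp: f_def C_def)
  moreover have "closed ((S p - {q}) \<union> C)"
    unfolding C_def by (rule closed_Un[OF finite_imp_closed closed_Times]) (simp_all add: fin)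
  moreover have "q \<in> f ` ?H" "q \<notin> (S p - {q}) \<union> C"
    using \<tau>_frontier p by (auto simp: q_def f_def C_def)
  ultimately have "f ` ?H \<inter> ((S p - {q}) \<union> C) = {}"
    using connected_closedD[of "f ` ?H" "{q}" "(S p - {q}) \<union> C"] by blast
  then have "f ` ?H \<subseteq> {q}"
    using sub by blast
  then have "u x = fst q" if "x \<in> ?H" for x
    using that by (force simp: f_def)
  then show ?thesis
    unfolding constant_on_def by blast
qed

text \<open>
  Since the interiors of the given holes cover the compact zero set, finitely many holes do. Any two
  of them are nested or disjoint, so the maximal ones are disjoint and still cover the zeros; replace
  \<open>u\<close> on each of them by its constant value on the frontier, whose norm is the positive level.
\<close>

lemma nonvanishing_modification:
  assumes t: "\<And>p. 0 < t p" "\<And>p. t p < r0"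
    and const: "\<And>z. u z = 0 \<Longrightarrow> \<exists>p::nat. u constant_on frontier (hole u (t p) z)"
  shows "\<exists>v. continuous_on UNIV v \<and> (\<forall>x. v x \<noteq> 0) \<and> (\<forall>x. 1 \<le> norm x \<longrightarrow> v x = u x)"
proof -
  define Z where "Z = {x. u x = 0}"
  obtain P where P: "\<And>z. z \<in> Z \<Longrightarrow> u constant_on frontier (hole u (t (P z)) z)"
    using const unfolding Z_def mem_Collect_eq by metis
  have "closed Z"
    unfolding Z_def by (intro closed_Collect_eq continuous_intros u_cont)
  moreover have "Z \<subseteq> ball 0 1"
  proof
    fix x assume "x \<in> Z"
    moreover have "0 < r0"
      using t[of 0] by linarith
    ultimately have "\<not> 1 \<le> norm x"
      using u_outside[of x] by (auto simp: Z_def)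
    then show "x \<in> ball 0 1" by simp
  qed
  ultimately have "compact Z"
    using bounded_subset[OF bounded_ball] by (auto simp: compact_eq_bounded_closed)
  moreover have "Z \<subseteq> (\<Union>z\<in>Z. interior (hole u (t (P z)) z))"
    using zero_in_interior_hole t(1) by (auto simp: Z_def)
  ultimately obtain Z' where Z': "Z' \<subseteq> Z" "finite Z'" "Z \<subseteq> (\<Union>z\<in>Z'. interior (hole u (t (P z)) z))"
    by (meson compactE_image open_interior)
  define \<G> where "\<G> = (\<lambda>z. hole u (t (P z)) z) ` Z'"
  define \<F> where "\<F> = {H \<in> \<G>. \<forall>K\<in>\<G>. H \<subseteq> K \<longrightarrow> H = K}"
  have fin: "finite \<G>" "finite \<F>"
    using Z'(2) by (auto simp: \<G>_def \<F>_def)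
  have comparable: "H \<subseteq> K \<or> K \<subseteq> H \<or> disjnt H K" if "H \<in> \<G>" "K \<in> \<G>" for H K
  proof -
    obtain z w where "H = hole u (t (P z)) z" "K = hole u (t (P w)) w"
      using \<open>H \<in> \<G>\<close> \<open>K \<in> \<G>\<close> by (auto simp: \<G>_def)
    then show ?thesis
      using hole_nested_or_disjoint[of "t (P z)" "t (P w)" z w]
        hole_nested_or_disjoint[of "t (P w)" "t (P z)" w z] by (metis disjnt_sym linear)
  qed
  have "pairwise disjnt \<F>"
  proof (rule pairwiseI)
    fix H K assume "H \<in> \<F>" "K \<in> \<F>" "H \<noteq> K"
    then show "disjnt H K"
      using comparable[of H K] unfolding \<F>_def mem_Collect_eq by metis
  qed
  have cover: "Z \<subseteq> \<Union>\<F>"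
  proof
    fix z assume "z \<in> Z"
    then obtain w where "w \<in> Z'" "z \<in> interior (hole u (t (P w)) w)"
      using Z'(3) by auto
    then obtain H where "H \<in> \<G>" "z \<in> H"
      using interior_subset unfolding \<G>_def by blast
    then obtain K where "K \<in> \<G>" "H \<subseteq> K" "\<And>L. \<lbrakk>L \<in> \<G>; K \<subseteq> L\<rbrakk> \<Longrightarrow> K = L"
      using finite_has_maximal2[OF fin(1) \<open>H \<in> \<G>\<close>] by auto
    then show "z \<in> \<Union>\<F>"
      using \<open>z \<in> H\<close> by (auto simp: \<F>_def)
  qed
  have "\<exists>c. c \<noteq> 0 \<and> (\<forall>x\<in>frontier H. u x = c)" if H: "H \<in> \<F>" for H
  \<comment> \<open>Any nonzero constant serves when there is no frontier to match.\<close>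
  proof (cases "frontier H = {}")
    case True
    then show ?thesis by (intro exI[of _ 1]) auto
  next
    case False
    then obtain y where y: "y \<in> frontier H" by blast
    obtain z where z: "z \<in> Z" "H = hole u (t (P z)) z"
      using H Z'(1) by (auto simp: \<F>_def \<G>_def)
    then obtain c where c: "\<forall>x\<in>frontier H. u x = c"
      using P unfolding constant_on_def by blast
    have "norm (u y) = t (P z)"
      using y z(2) frontier_hole_level by blast
    then have "u y \<noteq> 0"
      using t(1)[of "P z"] by auto
    then show ?thesis
      using c y by (intro exI[of _ c]) auto
  qed
  then obtain c where c: "\<And>H. H \<in> \<F> \<Longrightarrow> c H \<noteq> 0" "\<And>H x. \<lbrakk>H \<in> \<F>; x \<in> frontier H\<rbrakk> \<Longrightarrow> u x = c H"
    by metis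
  have closed: "closed H" if "H \<in> \<F>" for H
    using that closed_hole by (auto simp: \<F>_def \<G>_def)
  have "\<exists>v. continuous_on UNIV v \<and> (\<forall>x. x \<notin> \<Union>\<F> \<longrightarrow> v x = u x) \<and> (\<forall>H\<in>\<F>. \<forall>x\<in>H. v x = c H)"
    using fin(2) u_cont closed \<open>pairwise disjnt \<F>\<close> c(2)
    by (rule continuous_constant_on_closed_sets)
  then obtain v where v: "continuous_on UNIV v" "\<forall>x. x \<notin> \<Union>\<F> \<longrightarrow> v x = u x"
      "\<forall>H\<in>\<F>. \<forall>x\<in>H. v x = c H"
    by (elim exE conjE)
  have "v x \<noteq> 0" for x
  proof (cases "x \<in> \<Union>\<F>")
    case True
    then show ?thesis
      using v(3) c(1) by auto
  next
    case False
    then have "x \<notin> Z" "v x = u x"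
      using cover v(2) by auto
    then show ?thesis
      by (simp add: Z_def)
  qed
  moreover have "v x = u x" if "1 \<le> norm x" for x
  proof -
    have "x \<notin> \<Union>\<F>"
      using subsetD[OF hole_subset_ball[OF t(2)], of x] that by (auto simp: \<F>_def \<G>_def)
    then show ?thesis
      using v(2) by blast
  qed
  ultimately show ?thesis
    using v(1) by blast
qed

end

section \<open>The outer circle of the rotated sine curve\<close>

definition space_point :: "complex \<Rightarrow> real \<Rightarrow> real^3" where
  "space_point w z = vector [Re w, Im w, z]"

lemma space_point_nth [simp]:
  "space_point w z $ 1 = Re w" "space_point w z $ 2 = Im w" "space_point w z $ 3 = z"
  by (simp_all add: space_point_def vector_3)

lemma cyl_eq_space_point: "cyl r \<phi> z = space_point (of_real r * cis \<phi>) z"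
  by (simp add: cyl_def space_point_def)

lemma space_point_axes:
  "space_point w z = Re w *\<^sub>R axis 1 1 + Im w *\<^sub>R axis 2 1 + z *\<^sub>R axis 3 1"
  by (simp add: vec_eq_iff forall_3 axis_def)

lemma continuous_on_space_point [continuous_intros]:
  assumes "continuous_on S f" "continuous_on S g"
  shows "continuous_on S (\<lambda>x. space_point (f x) (g x))"
  unfolding space_point_axes by (intro continuous_intros assms)

lemma dist_space_point_le: "dist (space_point w z) (space_point w' z) \<le> 2 * dist w w'"
proof -
  have "space_point w z - space_point w' z = Re (w - w') *\<^sub>R axis 1 1 + Im (w - w') *\<^sub>R axis 2 1"
    by (simp add: space_point_axes algebra_simps)
  then have "dist (space_point w z) (space_point w' z)
      \<le> norm (Re (w - w') *\<^sub>R (axis 1 1 :: real^3)) + norm (Im (w - w') *\<^sub>R (axis 2 1 :: real^3))"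
    by (metis dist_norm norm_triangle_ineq)
  also have "\<dots> \<le> norm (w - w') + norm (w - w')"
    using abs_Re_le_cmod[of "w - w'"] abs_Im_le_cmod[of "w - w'"] by simp
  finally show ?thesis by (simp add: dist_norm)
qed

lemma cyl_in_space_B:
  assumes "(r, \<phi>, z) \<in> space_A r0 \<rho> \<theta>" "0 \<le> r" "r \<le> r0"
  shows "cyl (r0 - r) \<phi> z \<in> space_B r0 \<rho> \<theta>"
  unfolding space_B_def using assms by blast

lemma surface_in_space_B:
  assumes "0 < r" "r \<le> r0" "norm w = r0 - r"
  shows "space_point w (sin (1 / r)) \<in> space_B r0 \<rho> \<theta>"
proof -
  have "w = of_real (r0 - r) * cis (Arg w)"
    using rcis_cmod_Arg[of w] assms by (simp add: rcis_def)
  then have "space_point w (sin (1 / r)) = cyl (r0 - r) (Arg w) (sin (1 / r))"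
    by (simp only: cyl_eq_space_point)
  moreover have "(r, Arg w, sin (1 / r)) \<in> space_A r0 \<rho> \<theta>"
    using assms by (simp add: space_A_def sine_surface_def)
  ultimately show ?thesis
    using cyl_in_space_B[of r] assms by simp
qed

lemma annulus_in_space_B:
  assumes "0 < r0" "norm w = r0" "- 1 \<le> z" "z \<le> 1"
  shows "space_point w z \<in> space_B r0 \<rho> \<theta>"
proof -
  have "w = of_real (r0 - 0) * cis (Arg w)"
    using rcis_cmod_Arg[of w] assms by (simp add: rcis_def)
  then have "space_point w z = cyl (r0 - 0) (Arg w) z"
    by (simp only: cyl_eq_space_point)
  moreover have "(0, Arg w, z) \<in> space_A r0 \<rho> \<theta>"
    using assms by (simp add: space_A_def limit_arc_def)
  ultimately show ?thesis
    using cyl_in_space_B[of 0] assms by simp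
qed

text \<open>
  The slice of \<open>B\<close> at depth \<open>s\<close>: a circle, at the height of the sine curve, and one point for each
  connecting arc that is long enough to reach this depth.
\<close>

lemma space_B_level:
  assumes "a \<in> space_B r0 \<rho> \<theta>" "0 < s" "norm (Complex (a $ 1) (a $ 2)) = r0 - s"
  shows "a $ 3 = sin (1 / s) \<or>
    (\<exists>n\<ge>1. s \<le> \<rho> n \<and> Complex (a $ 1) (a $ 2) = of_real (r0 - s) * cis (\<theta> n) \<and> a $ 3 = sin (1 / \<rho> n))"
proof -
  obtain r \<phi> z where a: "a = space_point (of_real (r0 - r) * cis \<phi>) z" and A: "(r, \<phi>, z) \<in> space_A r0 \<rho> \<theta>"
    and r: "0 \<le> r" "r \<le> r0"
    using assms(1) by (auto simp: space_B_def cyl_eq_space_point)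
  have u: "Complex (a $ 1) (a $ 2) = of_real (r0 - r) * cis \<phi>"
    by (simp add: a complex_eq_iff)
  then have "norm (Complex (a $ 1) (a $ 2)) = r0 - r"
    using r by (simp add: norm_mult del: of_real_diff)
  then have "r = s"
    using assms(3) by linarith
  then show ?thesis
    using A u assms(2)
    by (auto simp: space_A_def sine_surface_def limit_arc_def connecting_arc_def a)
qed

definition outer_circle :: "real \<Rightarrow> complex \<Rightarrow> real^3" where
  "outer_circle r0 x = space_point (of_real r0 * x) 0"

lemma loop_in_outer_circle:
  assumes "0 < r0"
  shows "loop_in (top_of_set (space_B r0 \<rho> \<theta>)) (outer_circle r0)"
proof -
  have "continuous_on (sphere 0 1) (outer_circle r0)"
    unfolding outer_circle_def by (intro continuous_intros)
  moreover have "outer_circle r0 x \<in> space_B r0 \<rho> \<theta>" if "norm x = 1" for x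
    unfolding outer_circle_def using assms that by (intro annulus_in_space_B) (auto simp: norm_mult)
  ultimately show ?thesis
    by (auto simp: loop_in_def)
qed

text \<open>
  At depth \<open>1 / (k * pi)\<close> the surface has height \<open>0\<close>. The part of the surface at greater depth is a disc
  bounded by the circle at this depth.
\<close>

lemma outer_circle_near_inessential:
  assumes "0 < r0" "0 < \<epsilon>"
  shows "\<exists>\<gamma>'. inessential (top_of_set (space_B r0 \<rho> \<theta>)) \<gamma>' \<and>
    (\<forall>x\<in>sphere 0 1. dist (outer_circle r0 x) (\<gamma>' x) < \<epsilon>)"
proof -
  obtain k :: nat where k: "max (1 / r0) (2 / \<epsilon>) < real k"
    using reals_Archimedean2 by blast
  have "0 < 1 / r0"
    using assms by simp
  then have k0: "0 < real k"
    using k by linarith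
  define r where "r = 1 / (real k * pi)"
  have "real k * 1 \<le> real k * pi"
    using pi_ge_two k0 by (intro mult_left_mono) auto
  then have big: "1 / r0 < real k * pi" "2 / \<epsilon> < real k * pi"
    using k by linarith+
  have r: "0 < r" "r \<le> r0" "2 * r < \<epsilon>"
    using big assms k0 by (auto simp: r_def field_simps)
  have sin_r: "sin (1 / r) = 0"
    by (simp add: r_def sin_npi)
  \<comment> \<open>A parametrisation of that disc: \<open>norm x = 1\<close> has depth \<open>r\<close>, and the centre has depth \<open>r0\<close>.\<close>
  define G where
    "G = (\<lambda>x::complex. space_point (of_real (r0 - r) * x) (sin (1 / (r0 - (r0 - r) * norm x))))"
  have pos: "r \<le> r0 - (r0 - r) * norm x" if "x \<in> cball 0 1" for x :: complex
    using mult_left_mono[of "norm x" 1 "r0 - r"] that r by simp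
  have "r0 - (r0 - r) * norm x \<noteq> 0" if "x \<in> cball 0 1" for x :: complex
    using pos[OF that] r(1) by linarith
  then have "continuous_on (cball 0 1) G"
    unfolding G_def by (intro continuous_intros) auto
  moreover have "G x \<in> space_B r0 \<rho> \<theta>" if "x \<in> cball 0 1" for x
    unfolding G_def using pos[OF that] r
    by (intro surface_in_space_B) (auto simp: norm_mult simp del: of_real_diff)
  ultimately have "inessential (top_of_set (space_B r0 \<rho> \<theta>)) G"
    unfolding inessential_def by (intro exI[of _ G]) auto
  moreover have "dist (outer_circle r0 x) (G x) < \<epsilon>" if "x \<in> sphere 0 1" for x
  proof -
    have "G x = space_point (of_real (r0 - r) * x) 0"
      using that sin_r by (simp add: G_def)
    then have "dist (outer_circle r0 x) (G x) \<le> 2 * dist (of_real r0 * x) (of_real (r0 - r) * x)"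
      by (simp add: outer_circle_def dist_space_point_le del: of_real_diff)
    also have "of_real r0 * x - of_real (r0 - r) * x = of_real r * x"
      by (simp add: algebra_simps)
    then have "dist (of_real r0 * x) (of_real (r0 - r) * x) = r"
      using that r by (simp add: dist_norm norm_mult)
    finally show ?thesis
      using r(3) by simp
  qed
  ultimately show ?thesis by blast
qed

text \<open>
  Normalising \<open>v\<close> would give a retraction of the disc onto its boundary circle.
\<close>

lemma no_nonvanishing_extension:
  fixes v :: "complex \<Rightarrow> complex"
  assumes v: "continuous_on UNIV v" "\<And>x. v x \<noteq> 0" and r0: "0 < r0"
    and circle: "\<And>x. norm x = 1 \<Longrightarrow> v x = of_real r0 * x"
  shows False
proof -
  have "continuous_on (cball 0 1) (\<lambda>x. v x /\<^sub>R norm (v x))"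
    using v by (intro continuous_intros continuous_on_subset[OF v(1)]) auto
  moreover have "v x /\<^sub>R norm (v x) = x" if "norm x = 1" for x
    using circle[OF that] that r0 by (simp add: norm_mult scaleR_conv_of_real field_simps)
  ultimately have "sphere 0 1 retract_of (cball (0::complex) 1)"
    unfolding retract_of_def retraction_def using v(2)
    by (intro exI[of _ "\<lambda>x. v x /\<^sub>R norm (v x)"]) auto
  then show False
    using no_retraction_cball[of 1 "0::complex"] by simp
qed

text \<open>
  A filling \<open>F\<close> of the outer circle is extended to the plane by radial projection to the disc, so that
  \<open>u\<close> has norm \<open>r0\<close> on the whole exterior. Because \<open>\<rho> \<longlonglongrightarrow> 0\<close>, only finitely many connecting arcs
  reach a given depth, which makes the exceptional set \<open>S p\<close> of each level finite.
\<close>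

lemma not_inessential_outer_circle:
  assumes r0: "0 < r0" and data: "arc_data r0 \<rho> \<theta>"
  shows "\<not> inessential (top_of_set (space_B r0 \<rho> \<theta>)) (outer_circle r0)"
proof
  assume "inessential (top_of_set (space_B r0 \<rho> \<theta>)) (outer_circle r0)"
  then obtain F where F_cont: "continuous_on (cball 0 1) F" and FB: "F \<in> cball 0 1 \<rightarrow> space_B r0 \<rho> \<theta>"
    and F_circle: "\<And>x. x \<in> sphere 0 1 \<Longrightarrow> F x = outer_circle r0 x"
    unfolding inessential_def by auto
  define clamp where "clamp = (\<lambda>x::complex. x /\<^sub>R max 1 (norm x))"
  have clamp: "clamp x \<in> cball 0 1" for x
    by (auto simp: clamp_def max_def field_simps)
  have "continuous_on UNIV clamp"
    unfolding clamp_def by (intro continuous_intros) (auto simp: max_def)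
  then have E_cont: "continuous_on UNIV (\<lambda>x. F (clamp x))"
    using clamp by (intro continuous_on_compose2[OF F_cont]) auto
  have EB: "F (clamp x) \<in> space_B r0 \<rho> \<theta>" for x
    using FB clamp by blast
  define u where "u = (\<lambda>x. Complex (F (clamp x) $ 1) (F (clamp x) $ 2))"
  define h where "h = (\<lambda>x. F (clamp x) $ 3)"
  have h_cont: "continuous_on UNIV h"
    unfolding h_def by (intro continuous_intros E_cont)
  have u_cont: "continuous_on UNIV u"
    unfolding u_def Complex_eq by (intro continuous_intros E_cont)
  have clamp_outside: "norm (clamp x) = 1" if "1 \<le> norm x" for x
  proof -
    have "norm x \<noteq> 0"
      using that by linarith
    then show ?thesis
      using that by (auto simp: clamp_def max_def)
  qed
  have u_outer: "u x = of_real r0 * clamp x" if "1 \<le> norm x" for x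
    using clamp_outside[OF that] by (simp add: u_def F_circle outer_circle_def complex_eq_iff)
  have u_outside: "norm (u x) = r0" if "1 \<le> norm x" for x
    using u_outer[OF that] clamp_outside[OF that] r0 by (simp add: norm_mult)
  obtain M :: nat where M: "1 / r0 < real M"
    using reals_Archimedean2 by blast
  \<comment> \<open>Depths of the extrema of the sine curve. The even shift \<open>2 * M\<close>
    makes all of them smaller than \<open>r0\<close> and keeps the signs.\<close>
  define s where "s = (\<lambda>p. 1 / (pi / 2 + real (p + 2 * M) * pi))"
  define t where "t = (\<lambda>p. r0 - s p)"
  have s_pos: "0 < s p" for p
    by (simp add: s_def add_pos_nonneg)
  have s_less: "s p < r0" for p
  proof -
    have "real M * 1 \<le> real (p + 2 * M) * pi"
      using pi_ge_two by (intro mult_mono) auto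
    then have "1 / r0 < pi / 2 + real (p + 2 * M) * pi"
      using M pi_gt_zero by linarith
    then show ?thesis
      using r0 s_pos[of p] by (simp add: s_def field_simps)
  qed
  have sin_s: "sin (1 / s p) = (- 1) ^ p" for p
  proof -
    have "sin (1 / s p) = cos (real (p + 2 * M) * pi)"
      by (simp add: s_def sin_add)
    also have "\<dots> = (- 1) ^ (p + 2 * M)"
      by (rule cos_npi)
    finally show ?thesis by (simp add: power_add)
  qed
  define S where "S = (\<lambda>p. (\<lambda>n. (of_real (t p) * cis (\<theta> n), sin (1 / \<rho> n))) ` {n. s p \<le> \<rho> n})"
  have fin: "finite (S p)" for p
  proof -
    have "\<rho> \<longlonglongrightarrow> 0"
      using data by (simp add: arc_data_def)
    then obtain N where N: "\<And>n. N \<le> n \<Longrightarrow> \<rho> n < s p"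
      using order_tendstoD(2)[OF _ s_pos] by (metis eventually_sequentially)
    have "{n. s p \<le> \<rho> n} \<subseteq> {..<N}"
      using N by (auto simp: not_le[symmetric])
    then show ?thesis
      unfolding S_def using finite_subset by blast
  qed
  have t: "0 < t p" "t p < r0" for p
    using s_pos s_less by (auto simp: t_def)
  have "incseq t"
  proof (rule incseq_SucI)
    fix p
    have "s (Suc p) \<le> s p"
      unfolding s_def by (intro divide_left_mono add_left_mono mult_right_mono mult_pos_pos add_pos_nonneg) auto
    then show "t p \<le> t (Suc p)"
      by (simp add: t_def)
  qed
  have level: "h x = (- 1) ^ p \<or> (u x, h x) \<in> S p" if "norm (u x) = t p" for x p
    using space_B_level[OF EB s_pos, of x p] that sin_s[of p] by (auto simp: u_def h_def t_def S_def)
  have const: "\<exists>p. u constant_on frontier (hole u (t p) z)" if "u z = 0" for z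
    using u_cont u_outside h_cont \<open>incseq t\<close> t level fin that
    by (rule constant_on_frontier_of_some_hole)
  have "\<exists>v. continuous_on UNIV v \<and> (\<forall>x. v x \<noteq> 0) \<and> (\<forall>x. 1 \<le> norm x \<longrightarrow> v x = u x)"
    using u_cont u_outside t const by (rule nonvanishing_modification)
  then obtain v where v: "continuous_on UNIV v" "\<And>x. v x \<noteq> 0" "\<And>x. 1 \<le> norm x \<Longrightarrow> v x = u x"
    by blast
  have "v x = of_real r0 * x" if "norm x = 1" for x
    using v(3)[of x] u_outer[of x] that by (simp add: clamp_def)
  then show False
    using no_nonvanishing_extension v(1,2) r0 by blast
qed

theorem theorem3p4:
  fixes r0 :: real and \<rho> \<theta> :: "nat \<Rightarrow> real"
  assumes "0 < r0"
    and "arc_data r0 \<rho> \<theta>"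
  shows "\<not> pi1_shape_injective TYPE('r) (top_of_set (space_B r0 \<rho> \<theta>))"
proof
  let ?B = "space_B r0 \<rho> \<theta>"
  assume "pi1_shape_injective TYPE('r) (top_of_set ?B)"
  then obtain R :: "'r topology" and e where R: "absolute_retract R"
    and e: "embedding_map (top_of_set ?B) R e"
    and ess: "\<And>\<gamma>. essential (top_of_set ?B) \<gamma> \<Longrightarrow>
      \<exists>U V. openin R U \<and> e ` ?B \<subseteq> U \<and> U \<subseteq> V \<and> V \<subseteq> topspace R \<and> essential (subtopology R V) (e \<circ> \<gamma>)"
    unfolding pi1_shape_injective_def by auto
  have "essential (top_of_set ?B) (outer_circle r0)"
    using loop_in_outer_circle[OF assms(1)] not_inessential_outer_circle[OF assms]
    by (simp add: essential_def)
  from ess[OF this] obtain U V where U: "openin R U" "e ` ?B \<subseteq> U" and "U \<subseteq> V"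
    and V: "essential (subtopology R V) (e \<circ> outer_circle r0)"
    by (elim exE conjE)
  have "continuous_map (top_of_set ?B) (subtopology R (e ` topspace (top_of_set ?B))) e"
    using e unfolding embedding_map_def by (rule homeomorphic_imp_continuous_map)
  then have "continuous_map (top_of_set ?B) R e"
    by (simp add: continuous_map_in_subtopology)
  then have "inessential (subtopology R U) (e \<circ> outer_circle r0)"
    by (rule inessential_limit_of_inessential[OF R _ U loop_in_outer_circle[OF assms(1)]
        outer_circle_near_inessential[OF assms(1)]])
  then have "inessential (subtopology R V) (e \<circ> outer_circle r0)"
    using \<open>U \<subseteq> V\<close>
    unfolding inessential_def continuous_map_in_subtopology by fast
  with V show False
    by (simp add: essential_def)
qed

end
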